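(* Let $m$ be an odd positive integer. The weight distribution $A_i$, $i=0,\ldots,2^{m+1}$ (where $A_i$ is the number of codewords of Hamming weight $i$), of the binary Kerdock code of length $2^{m+1}$ is as follows: $A_0=1$, $A_{2^m-2^{(m-1)/2}}=2^{2m+1}-2^{m+1}$, $A_{2^m}=2^{m+2}-2$, $A_{2^m+2^{(m-1)/2}}=2^{2m+1}-2^{m+1}$, $A_{2^{m+1}}=1$, and $A_i=0$ for all other $i$.
   Context: Field setup: $\mathbb{F}_{2^m}$ is obtained from $\mathbb{F}_2$ by adjoining a root $\alpha$ of a primitive irreducible polynomial of degree $m$; the element $z_0+z_1\alpha+\cdots+z_{m-1}\alpha^{m-1}$ is identified with the binary row vector $[z_0,\ldots,z_{m-1}]\in\mathbb{F}_2^m$. $\mathrm{Tr}(x)=x+x^2+\cdots+x^{2^{m-1}}$ is the trace map $\mathbb{F}_{2^m}\to\mathbb{F}_2$. $W$ is the $m\times m$ binary symmetric matrix with $\mathrm{Tr}(xy)=xWy^T$, and for $z\in\mathbb{F}_{2^m}$, $A_z$ is the $m\times m$ binary matrix with $xA_z=xz$ (field product) for all $x$. The Kerdock set is $P_{\mathrm{K}}(m)=\{P_z=A_zW: z\in\mathbb{F}_{2^m}\}$ (so $xP_zy^T=\mathrm{Tr}(zxy)$). The $\mathbb{Z}_4$-linear Kerdock code of length $2^m$ is $\mathrm{K}(m)=\{[xPx^T+2wx^T+\kappa \bmod 4]_{x\in\mathbb{F}_2^m} : P\in P_{\mathrm{K}}(m),\ w\in\mathbb{F}_2^m,\ \kappa\in\mathbb{Z}_4\}$,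 where the entries of $x,w,P$ are regarded as integers $0,1$ when computing modulo 4. The Gray map $\mathfrak{g}:\mathbb{Z}_4\to\mathbb{F}_2^2$ is $\mathfrak{g}(0)=00$, $\mathfrak{g}(1)=01$, $\mathfrak{g}(2)=11$, $\mathfrak{g}(3)=10$, applied entrywise (with concatenation) to vectors. The binary (non-linear) Kerdock code of length $2^{m+1}$ is $\mathfrak{g}(\mathrm{K}(m))$. *)

theory Defs
  imports
    Jordan_Normal_Form.Matrix
    "HOL-Library.Z2"
    "HOL-Computational_Algebra.Computational_Algebra"
begin

text \<open>
  The field \<open>F\<^sub>2\<close> is \<^typ>\<open>bit\<close>, embedded into an extension field by \<open>of_bit\<close>.  Vectors of type
  \<^typ>\<open>bit vec\<close> are read as row vectors, so that \<open>x A\<close> is \<open>transpose_mat A *\<^sub>v x\<close> and \<open>x A y\<^sup>T\<close> is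
  \<open>x \<bullet> (A *\<^sub>v y)\<close>.
\<close>

text \<open>
  The second and third conjuncts say that the class of \<open>X\<close> in \<open>F\<^sub>2[X]/(f)\<close> has multiplicative
  order exactly \<open>2 ^ degree f - 1\<close>.
\<close>

definition primitive_polynomial :: "bit poly \<Rightarrow> bool" where
  "primitive_polynomial f \<longleftrightarrow>
     irreducible f \<and>
     f dvd monom 1 (2 ^ degree f - 1) - 1 \<and>
     (\<forall>n. 0 < n \<and> n < 2 ^ degree f - 1 \<longrightarrow> \<not> f dvd monom 1 n - 1)"

text \<open>
  \<open>'a\<close> is the field obtained from \<open>F\<^sub>2\<close> by adjoining the root \<open>\<alpha>\<close> of \<open>f\<close>.  As \<open>\<alpha>\<close> is algebraic,
  \<open>F\<^sub>2(\<alpha>)\<close> consists of the polynomial expressions in \<open>\<alpha>\<close>.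
\<close>

definition adjoins_root :: "bit poly \<Rightarrow> 'a::field \<Rightarrow> bool" where
  "adjoins_root f \<alpha> \<longleftrightarrow>
     CHAR('a) = 2 \<and>
     poly (map_poly of_bit f) \<alpha> = 0 \<and>
     (\<forall>x::'a. \<exists>q::bit poly. x = poly (map_poly of_bit q) \<alpha>)"

definition field_elem :: "'a::field \<Rightarrow> bit vec \<Rightarrow> 'a" where
  "field_elem \<alpha> z = (\<Sum>i<dim_vec z. of_bit (z $ i) * \<alpha> ^ i)"

text \<open>The trace to \<open>F\<^sub>2\<close>, with values in the copy of \<open>F\<^sub>2\<close> inside \<open>'a\<close>.\<close>

definition field_trace :: "nat \<Rightarrow> 'a::field \<Rightarrow> 'a" where
  "field_trace m x = (\<Sum>i<m. x ^ (2 ^ i))"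

definition trace_mat :: "'a::field \<Rightarrow> nat \<Rightarrow> bit mat" where
  "trace_mat \<alpha> m = (THE W. W \<in> carrier_mat m m \<and> transpose_mat W = W \<and>
     (\<forall>x\<in>carrier_vec m. \<forall>y\<in>carrier_vec m.
        field_trace m (field_elem \<alpha> x * field_elem \<alpha> y) = of_bit (x \<bullet> (W *\<^sub>v y))))"

definition mult_mat :: "'a::field \<Rightarrow> nat \<Rightarrow> 'a \<Rightarrow> bit mat" where
  "mult_mat \<alpha> m z = (THE A. A \<in> carrier_mat m m \<and>
     (\<forall>x\<in>carrier_vec m. field_elem \<alpha> (transpose_mat A *\<^sub>v x) = field_elem \<alpha> x * z))"

definition kerdock_set :: "'a::field \<Rightarrow> nat \<Rightarrow> bit mat set" where
  "kerdock_set \<alpha> m = {mult_mat \<alpha> m z * trace_mat \<alpha> m | z. True}"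

text \<open>
  Elements of \<open>Z\<^sub>4\<close> are represented by the integers \<open>0, 1, 2, 3\<close>.  The list \<open>xs\<close> enumerates
  \<open>F\<^sub>2\<^sup>m\<close> and fixes the order of the coordinates of a codeword.  All products and sums are
  computed over the integers before reducing modulo 4.
\<close>

definition kerdock_code_Z4 :: "'a::field \<Rightarrow> nat \<Rightarrow> bit vec list \<Rightarrow> int list set" where
  "kerdock_code_Z4 \<alpha> m xs =
     {map (\<lambda>x. let x' = map_vec of_bit x; w' = map_vec of_bit w; P' = map_mat of_bit P
               in (x' \<bullet> (P' *\<^sub>v x') + 2 * (w' \<bullet> x') + \<kappa>) mod 4) xs
      | P w \<kappa>. P \<in> kerdock_set \<alpha> m \<and> w \<in> carrier_vec m \<and> \<kappa> \<in> {0, 1, 2, 3}}"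

text \<open>The last branch is the value at 3.\<close>

definition gray :: "int \<Rightarrow> bit list" where
  "gray k = (if k = 0 then [0, 0] else if k = 1 then [0, 1] else if k = 2 then [1, 1] else [1, 0])"

definition gray_map :: "int list \<Rightarrow> bit list" where
  "gray_map c = concat (map gray c)"

definition binary_kerdock_code :: "'a::field \<Rightarrow> nat \<Rightarrow> bit vec list \<Rightarrow> bit list set" where
  "binary_kerdock_code \<alpha> m xs = gray_map ` kerdock_code_Z4 \<alpha> m xs"

definition hamming_weight :: "bit list \<Rightarrow> nat" where
  "hamming_weight c = length (filter (\<lambda>b. b \<noteq> 0) c)"

definition weight_distribution :: "bit list set \<Rightarrow> nat \<Rightarrow> nat" where
  "weight_distribution C i = card {c \<in> C. hamming_weight c = i}"

end

theory Submission
  imports Defs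
begin

text \<open>
  A codeword \<open>c\<close> over \<open>Z\<^sub>4\<close> has Gray weight \<open>2\<^sup>m - Re S\<close>, where \<open>S\<close> is the sum of \<open>i ^ c(x)\<close> over all \<open>x\<close>.
  Let \<open>q(x) = xPx\<^sup>T + 2wx\<^sup>T\<close>, so that \<open>c = q + \<kappa>\<close>.  As \<open>P\<close> is symmetric,
  \<open>q(x + y) = q(x) + q(y) + 2xPy\<^sup>T\<close> modulo 4, where \<open>x + y\<close> is computed over \<open>F\<^sub>2\<close>.  If \<open>P\<close> comes from a
  nonzero field element, then the trace form makes it nondegenerate, and expanding \<open>|S|\<^sup>2\<close> gives
  \<open>2\<^sup>m\<close>.  As \<open>m\<close> is odd, the only Gaussian integers of norm \<open>2\<^sup>m\<close> have real part \<open>\<plusminus>2\<^sup>k\<close> with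
  \<open>k = (m - 1)/2\<close>, and adding 2 to \<open>\<kappa>\<close> changes the sign of \<open>S\<close>, so each sign occurs for two of the
  four \<open>\<kappa>\<close>.  For \<open>P = 0\<close> the word is affine and its sum is elementary.  Distinct parameters give
  distinct codewords because \<open>c\<close> modulo 2 determines \<open>Tr(zx\<^sup>2)\<close> and hence \<open>z\<close>.
\<close>

section \<open>Forms modulo 4\<close>

text \<open>These default simplification rules turn addition and multiplication of bits into \<open>XOR\<close> and
  \<open>AND\<close>, and sums of \<open>of_bit\<close> into cardinalities, which hides the ring structure.\<close>

declare add_bit_eq_xor [simp del] mult_bit_eq_and [simp del]
declare sum_of_bool_eq [simp del] sum_of_bool_mult_eq [simp del] sum_mult_of_bool_eq [simp del]

section \<open>Bits, bit vectors and their integer lifts\<close>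

lemma of_bit_inject: "(of_bit a :: 'a::zero_neq_one) = of_bit b \<longleftrightarrow> a = b"
  by (cases a; cases b) simp_all

lemma of_bit_mult: "(of_bit (a * b) :: 'a::{semiring_1,zero_neq_one}) = of_bit a * of_bit b"
  by (cases a; cases b) simp_all

lemma of_bit_add_char2:
  assumes "CHAR('a::field) = 2"
  shows "(of_bit (a + b) :: 'a) = of_bit a + of_bit b"
proof -
  have "(1 + 1 :: 'a) = of_nat CHAR('a)" unfolding assms by simp
  then have "(1 + 1 :: 'a) = 0" by (simp only: of_nat_CHAR)
  then show ?thesis by (cases a; cases b) simp_all
qed

lemma of_bit_sum_char2:
  assumes "CHAR('a::field) = 2"
  shows "(of_bit (sum g S) :: 'a) = (\<Sum>i\<in>S. of_bit (g i))"
proof (induction S rule: infinite_finite_induct)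
  case (insert i S)
  show ?case
    unfolding sum.insert [OF insert.hyps] of_bit_add_char2 [OF assms] insert.IH ..
qed simp_all

lemma of_bit_add_int: "(of_bit (a + b) :: int) = of_bit a + of_bit b - 2 * (of_bit a * of_bit b)"
  by (cases a; cases b) simp_all

lemma of_bool_bit_eq_1 [simp]: "of_bool (a = 1) = (a :: bit)"
  by (cases a) simp_all

lemma of_int_of_bit: "of_int (of_bit a) = (a :: bit)"
  by simp

text \<open>Parity claims about integers are settled in \<open>bit\<close>: there
  \<open>of_int\<close> is a ring homomorphism that undoes \<open>of_bit\<close>.\<close>

lemma of_int_bit_eq_0_iff: "of_int k = (0 :: bit) \<longleftrightarrow> even k"
  by (cases "even k") (auto elim!: evenE oddE)

abbreviation int_vec :: "bit vec \<Rightarrow> int vec" where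
  "int_vec \<equiv> map_vec of_bit"

abbreviation int_mat :: "bit mat \<Rightarrow> int mat" where
  "int_mat \<equiv> map_mat of_bit"

lemma of_int_scalar_prod_int_vec:
  assumes "dim_vec x = dim_vec y"
  shows "of_int (int_vec x \<bullet> int_vec y) = x \<bullet> y"
  using assms by (simp add: scalar_prod_def of_int_of_bit)

lemma of_int_bilinear_int_vec:
  assumes "x \<in> carrier_vec m" "y \<in> carrier_vec m" "P \<in> carrier_mat m m"
  shows "of_int (int_vec x \<bullet> (int_mat P *\<^sub>v int_vec y)) = x \<bullet> (P *\<^sub>v y)"
  using assms by (simp add: scalar_prod_def of_int_of_bit)

text \<open>The lift of a sum over \<open>bit\<close> differs from the integer sum by the carries.
  Only the evenness of this correction is used later, so the vector \<open>u\<close> is left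
  unspecified.\<close>

lemma int_vec_add:
  assumes "x \<in> carrier_vec m" "y \<in> carrier_vec m"
  obtains u where "u \<in> carrier_vec m" "int_vec (x + y) = int_vec x + int_vec y + 2 \<cdot>\<^sub>v u"
proof
  show "vec m (\<lambda>i. - (of_bit (x $ i) * of_bit (y $ i))) \<in> carrier_vec m" by simp
  show "int_vec (x + y) = int_vec x + int_vec y
      + 2 \<cdot>\<^sub>v vec m (\<lambda>i. - (of_bit (x $ i) * of_bit (y $ i)))"
    using assms by (intro eq_vecI) (simp_all only: of_bit_add_int [symmetric] index_map_vec index_add_vec
      index_smult_vec index_vec dim_vec index_map_vec carrier_vecD mult_minus_right
      of_bit_add_int diff_conv_add_uminus)
qed

lemma bilinear_symmetric:
  fixes P :: "int mat"
  assumes "x \<in> carrier_vec m" "y \<in> carrier_vec m" "P \<in> carrier_mat m m" "transpose_mat P = P"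
  shows "x \<bullet> (P *\<^sub>v y) = y \<bullet> (P *\<^sub>v x)"
  by (metis assms transpose_vec_mult_scalar comm_scalar_prod mult_mat_vec_carrier)

lemma mult_mat_vec_smult:
  fixes A :: "'a::comm_ring_1 mat"
  assumes "A \<in> carrier_mat n k" "v \<in> carrier_vec k"
  shows "A *\<^sub>v (c \<cdot>\<^sub>v v) = c \<cdot>\<^sub>v (A *\<^sub>v v)"
  using assms by (intro eq_vecI) simp_all

section \<open>Quadratic forms with values modulo 4\<close>

definition kerdock_form :: "bit mat \<Rightarrow> bit vec \<Rightarrow> bit vec \<Rightarrow> int" where
  "kerdock_form P w x = int_vec x \<bullet> (int_mat P *\<^sub>v int_vec x) + 2 * (int_vec w \<bullet> int_vec x)"

lemma kerdock_form_0:
  assumes "P \<in> carrier_mat m m" "w \<in> carrier_vec m"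
  shows "kerdock_form P w (0\<^sub>v m) = 0"
proof -
  have "int_vec (0\<^sub>v m) = 0\<^sub>v m" by (intro eq_vecI) simp_all
  moreover have "int_mat P *\<^sub>v 0\<^sub>v m \<in> carrier_vec m"
    using assms(1) by (intro mult_mat_vec_carrier [of _ m m]) simp_all
  ultimately show ?thesis using assms(2) by (simp add: kerdock_form_def)
qed

text \<open>By symmetry of \<open>P\<close> every cross term occurs twice. A cross term with the
  carry vector has a further factor 2 and vanishes modulo 4; the one between \<open>x\<close> and
  \<open>y\<close> matters only modulo 2, where it is the bit
  \<open>x \<bullet> (P *\<^sub>v y)\<close>.\<close>

lemma kerdock_form_add:
  assumes "P \<in> carrier_mat m m" "transpose_mat P = P" "w \<in> carrier_vec m"
    and x: "x \<in> carrier_vec m" and y: "y \<in> carrier_vec m"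
  shows "kerdock_form P w (x + y) mod 4 =
    (kerdock_form P w x + kerdock_form P w y + 2 * of_bit (x \<bullet> (P *\<^sub>v y))) mod 4"
proof -
  define X Y Q W where "X = int_vec x" and "Y = int_vec y" and "Q = int_mat P" and "W = int_vec w"
  obtain u where u: "u \<in> carrier_vec m" and XY: "int_vec (x + y) = X + Y + 2 \<cdot>\<^sub>v u"
    using int_vec_add [OF x y] unfolding X_def Y_def by blast
  have c [simp]: "X \<in> carrier_vec m" "Y \<in> carrier_vec m" "Q \<in> carrier_mat m m" "W \<in> carrier_vec m"
    "u \<in> carrier_vec m"
    using assms u by (auto simp: X_def Y_def Q_def W_def)
  have c' [simp]: "Q *\<^sub>v v \<in> carrier_vec m" for v
    by (metis c(3) carrier_matD(1) carrier_vecI dim_mult_mat_vec)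
  have Qt: "transpose_mat Q = Q"
    unfolding Q_def map_mat_transpose assms(2) ..
  note sym = bilinear_symmetric [OF _ _ c(3) Qt]
  define b :: int where "b = of_bit (x \<bullet> (P *\<^sub>v y))"
  have "even (X \<bullet> (Q *\<^sub>v Y) - b)"
    unfolding of_int_bit_eq_0_iff [symmetric] of_int_diff of_int_of_bit b_def X_def Y_def Q_def
    using of_int_bilinear_int_vec [OF x y assms(1)] by simp
  \<comment> \<open>The integer bilinear value agrees with its bit up to \<open>2 * t\<close>; after
    doubling, the error is a multiple of 4.\<close>
  then obtain t where t: "X \<bullet> (Q *\<^sub>v Y) = b + 2 * t"
    by (metis diff_eq_eq dvdE add.commute)
  have "(X + Y + 2 \<cdot>\<^sub>v u) \<bullet> (Q *\<^sub>v (X + Y + 2 \<cdot>\<^sub>v u)) =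
    X \<bullet> (Q *\<^sub>v X) + Y \<bullet> (Q *\<^sub>v X) + 2 * (u \<bullet> (Q *\<^sub>v X))
    + (X \<bullet> (Q *\<^sub>v Y) + Y \<bullet> (Q *\<^sub>v Y) + 2 * (u \<bullet> (Q *\<^sub>v Y)))
    + 2 * (X \<bullet> (Q *\<^sub>v u) + Y \<bullet> (Q *\<^sub>v u) + 2 * (u \<bullet> (Q *\<^sub>v u)))"
    by (simp add: mult_add_distrib_mat_vec [of _ m m] scalar_prod_add_distrib [of _ m]
        add_scalar_prod_distrib [of _ m] mult_mat_vec_smult [of Q m m] smult_scalar_prod_distrib [of _ m]
        scalar_prod_smult_distrib [of _ m])
  moreover have "W \<bullet> (X + Y + 2 \<cdot>\<^sub>v u) = W \<bullet> X + W \<bullet> Y + 2 * (W \<bullet> u)"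
    by (simp add: scalar_prod_add_distrib [of _ m] scalar_prod_smult_distrib [of _ m])
  ultimately have "kerdock_form P w (x + y) =
    kerdock_form P w x + kerdock_form P w y + 2 * b
    + (t + u \<bullet> (Q *\<^sub>v X) + u \<bullet> (Q *\<^sub>v Y) + u \<bullet> (Q *\<^sub>v u) + W \<bullet> u) * 4"
    unfolding kerdock_form_def XY X_def [symmetric] Y_def [symmetric] Q_def [symmetric] W_def [symmetric]
    by (simp add: t sym [of Y X, OF c(2,1)] sym [of X u, OF c(1,5)] sym [of Y u, OF c(2,5)] algebra_simps)
  then show ?thesis unfolding b_def [symmetric] by (simp only: mod_mult_self1)
qed

text \<open>The real part of \<open>i\<^sup>k\<close>; the imaginary part is \<open>re4 (k - 1)\<close>.\<close>

definition re4 :: "int \<Rightarrow> int" where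
  "re4 k = (if k mod 4 = 0 then 1 else if k mod 4 = 2 then - 1 else 0)"

lemma re4_mod: "a mod 4 = b mod 4 \<Longrightarrow> re4 a = re4 b"
  by (simp add: re4_def)

lemma re4_add_2: "re4 (a + 2) = - re4 a"
  unfolding re4_def by presburger

lemma re4_add_even: "re4 (a + 2 * of_bit b) = (if b = 0 then 1 else - 1) * re4 a"
  by (cases b) (simp_all add: re4_add_2)

text \<open>This is the real part of \<open>i^a\<close> times the conjugate of \<open>i^b\<close>,
  the imaginary parts being \<open>re4 (a - 1)\<close> and \<open>re4 (b - 1)\<close>.\<close>

lemma re4_diff: "re4 a * re4 b + re4 (a - 1) * re4 (b - 1) = re4 (a - b)"
proof -
  \<comment> \<open>All terms depend only on residues modulo 4, so sixteen cases remain.\<close>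
  define i j where "i = a mod 4" and "j = b mod 4"
  have "re4 a = re4 i" "re4 b = re4 j" "re4 (a - 1) = re4 (i - 1)" "re4 (b - 1) = re4 (j - 1)"
    "re4 (a - b) = re4 (i - j)"
    unfolding i_def j_def by (rule re4_mod, simp add: mod_simps)+
  moreover have "re4 i * re4 j + re4 (i - 1) * re4 (j - 1) = re4 (i - j)"
  proof -
    have "i = 0 \<or> i = 1 \<or> i = 2 \<or> i = 3" "j = 0 \<or> j = 1 \<or> j = 2 \<or> j = 3"
      unfolding i_def j_def by presburger+
    then show ?thesis by (elim disjE) (simp_all add: re4_def)
  qed
  ultimately show ?thesis by (simp only:)
qed

text \<open>The Gray images of 0, 1, 2, 3 have weights 0, 1, 2, 1, and the real parts of the powers
  of \<open>i\<close> are 1, 0, -1, 0.\<close>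

lemma hamming_weight_gray: "int (hamming_weight (gray (k mod 4))) = 1 - re4 k"
proof -
  have "k mod 4 \<in> {0, 1, 2, 3}" by auto
  then show ?thesis by (auto simp: hamming_weight_def gray_def re4_def)
qed

lemma hamming_weight_gray_map:
  "int (hamming_weight (gray_map (map (\<lambda>x. g x mod 4) xs))) = (\<Sum>x\<leftarrow>xs. 1 - re4 (g x))"
proof (induction xs)
  case (Cons x xs)
  then show ?case using hamming_weight_gray [of "g x"]
    by (simp add: gray_map_def hamming_weight_def)
qed (simp add: gray_map_def hamming_weight_def)

text \<open>Blocks have constant length 2, so symbols can be read off one at a time. The restriction
  to residues matters: \<open>gray\<close> sends every other integer to the block of 3.\<close>

lemma inj_gray_map: "inj_on gray_map {c. set c \<subseteq> {0, 1, 2, 3}}"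
proof -
  have "c = d" if "gray_map c = gray_map d" "set c \<subseteq> {0, 1, 2, 3}" "set d \<subseteq> {0, 1, 2, 3}" for c d
    using that
  proof (induction c arbitrary: d)
    case Nil
    then show ?case by (cases d) (auto simp: gray_map_def gray_def split: if_splits)
  next
    case (Cons a c)
    then obtain b d' where "d = b # d'"
      by (cases d) (auto simp: gray_map_def gray_def split: if_splits)
    with Cons show ?case by (force simp: gray_map_def gray_def split: if_splits)
  qed
  then show ?thesis by (auto simp: inj_on_def)
qed

section \<open>Binary vectors, character sums and sums of two squares\<close>

lemma finite_carrier_bit_vec: "finite (carrier_vec m :: bit vec set)"
  and card_carrier_bit_vec: "card (carrier_vec m :: bit vec set) = 2 ^ m"
proof -
  have U: "(UNIV :: bit set) = {0, 1}" using bit.exhaust by auto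
  have eq: "(carrier_vec m :: bit vec set) = vec_of_list ` {c. set c \<subseteq> UNIV \<and> length c = m}" (is "_ = _ ` ?L")
  proof (intro equalityI subsetI)
    fix v :: "bit vec" assume "v \<in> carrier_vec m"
    then show "v \<in> vec_of_list ` ?L"
      by (intro image_eqI [of _ _ "list_of_vec v"]) (auto simp: vec_list)
  next
    fix v :: "bit vec" assume "v \<in> vec_of_list ` ?L"
    then obtain c where "length c = m" "v = vec_of_list c" by blast
    then show "v \<in> carrier_vec m" by (intro carrier_vecI) simp
  qed
  have inj: "inj_on vec_of_list ?L" by (rule inj_on_inverseI) (rule list_vec)
  have fin: "finite (UNIV :: bit set)" unfolding U by simp
  show "finite (carrier_vec m :: bit vec set)" unfolding eq
    by (intro finite_imageI finite_lists_length_eq fin)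
  have "card (UNIV :: bit set) = 2" unfolding U by simp
  then show "card (carrier_vec m :: bit vec set) = 2 ^ m" unfolding eq card_image [OF inj]
    by (subst card_lists_length_eq [OF fin]) simp
qed

lemma bit_vec_add_self: "x \<in> carrier_vec m \<Longrightarrow> x + x = (0\<^sub>v m :: bit vec)"
  by (intro eq_vecI) (auto simp flip: mult_2)

lemma bij_betw_add_bit_vec:
  assumes "d \<in> carrier_vec m"
  shows "bij_betw (\<lambda>x. x + d) (carrier_vec m) (carrier_vec m :: bit vec set)"
  by (rule bij_betw_byWitness [where f' = "\<lambda>x. x + d"])
    (use assms in \<open>auto simp: assoc_add_vec [of _ m] bit_vec_add_self [of _ m]\<close>)

text \<open>Orthogonality of characters: translation by \<open>d\<close> permutes the vectors and
  flips every sign, so the sum equals its own negative.\<close>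

lemma sum_sign_linear:
  fixes l :: "bit vec \<Rightarrow> bit"
  assumes add: "\<And>x y. x \<in> carrier_vec m \<Longrightarrow> y \<in> carrier_vec m \<Longrightarrow> l (x + y) = l x + l y"
    and d: "d \<in> carrier_vec m" "l d \<noteq> 0"
  shows "(\<Sum>x\<in>carrier_vec m. if l x = 0 then 1 else - 1 :: int) = 0" (is "?S = 0")
proof -
  have "?S = (\<Sum>x\<in>carrier_vec m. if l (x + d) = 0 then 1 else - 1)"
    by (rule sum.reindex_bij_betw [OF bij_betw_add_bit_vec [OF d(1)], symmetric])
  also have "\<dots> = (\<Sum>x\<in>carrier_vec m. - (if l x = 0 then 1 else - 1))"
  proof (rule sum.cong [OF refl])
    fix x :: "bit vec" assume "x \<in> carrier_vec m"
    with add [OF this d(1)] d(2)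
    show "(if l (x + d) = 0 then 1 else - 1) = - (if l x = 0 then 1 else - 1 :: int)"
      by (cases "l x") auto
  qed
  also have "\<dots> = - ?S" by (rule sum_negf)
  finally show ?thesis by simp
qed

text \<open>Descent on \<open>k\<close>: both numbers are even as long as the power is divisible by
  4, and halving them lowers \<open>k\<close> by one. At the bottom the only possibility is 2 = 1 +
  1.\<close>

lemma sum_two_squares_odd_power:
  fixes a b :: int
  assumes "a\<^sup>2 + b\<^sup>2 = 2 ^ (2 * k + 1)"
  shows "a\<^sup>2 = 2 ^ (2 * k)"
  using assms
proof (induction k arbitrary: a b)
  case 0
  \<comment> \<open>Since 2 is not a square, neither summand can be 0, so each is 1.\<close>
  have "c\<^sup>2 \<noteq> 2" for c :: int
  proof
    assume c: "c\<^sup>2 = 2"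
    then have "\<bar>c\<bar>\<^sup>2 < 2\<^sup>2" by simp
    then have "\<bar>c\<bar> < 2" by (rule power2_less_imp_less) simp
    then have "c = 0 \<or> c = 1 \<or> c = - 1" by auto
    with c show False by auto
  qed
  moreover have "a\<^sup>2 \<noteq> 0" "b\<^sup>2 \<noteq> 0"
    using calculation [of a] calculation [of b] 0 by auto
  ultimately have "a\<^sup>2 + b\<^sup>2 = 2" "a\<^sup>2 \<noteq> 0" "b\<^sup>2 \<noteq> 0" "a\<^sup>2 \<ge> 0" "b\<^sup>2 \<ge> 0"
    using 0 by simp_all
  then have "a\<^sup>2 = 1" by linarith
  then show ?case by simp
next
  case (Suc k)
  have "(a\<^sup>2 + b\<^sup>2) mod 4 = 0" using Suc.prems by simp
  \<comment> \<open>The parities agree because the sum is even, and two odd squares would add up to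
    2 modulo 4.\<close>
  have "even a \<and> even b"
  proof (rule ccontr)
    assume "\<not> (even a \<and> even b)"
    moreover have "even (a\<^sup>2 + b\<^sup>2)" using Suc.prems by simp
    ultimately have "odd a" "odd b" by auto
    then obtain s t where "a = 2 * s + 1" "b = 2 * t + 1" by (auto elim!: oddE)
    then have "a\<^sup>2 + b\<^sup>2 = 4 * (s * s + s + t * t + t) + 2" by (simp add: power2_eq_square algebra_simps)
    with \<open>(a\<^sup>2 + b\<^sup>2) mod 4 = 0\<close> show False by presburger
  qed
  then obtain s t where st: "a = 2 * s" "b = 2 * t" by (elim conjE dvdE)
  with Suc.prems have "s\<^sup>2 + t\<^sup>2 = 2 ^ (2 * k + 1)" by (simp add: power_mult_distrib)
  from Suc.IH [OF this] show ?case unfolding st by (simp add: power_mult_distrib)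
qed

section \<open>Exponential sums of the forms\<close>

definition kerdock_sum :: "nat \<Rightarrow> bit mat \<Rightarrow> bit vec \<Rightarrow> int \<Rightarrow> int" where
  "kerdock_sum m P w \<kappa> = (\<Sum>x\<in>carrier_vec m. re4 (kerdock_form P w x + \<kappa>))"

lemma kerdock_sum_add_2: "kerdock_sum m P w (\<kappa> + 2) = - kerdock_sum m P w \<kappa>"
  unfolding kerdock_sum_def add.assoc [symmetric] re4_add_2 by (rule sum_negf)

text \<open>The second square is that of the imaginary part, so the left side is the squared
  absolute value of the exponential sum. In its expansion as a double sum, the substitution
  \<open>x = d + y\<close> splits off a sign depending on \<open>y\<close>. Summing over
  \<open>y\<close> first removes every nonzero \<open>d\<close> by nondegeneracy, and
  \<open>d = 0\<close> contributes the number of vectors.\<close>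

lemma kerdock_sum_norm:
  assumes P: "P \<in> carrier_mat m m" "transpose_mat P = P" and w: "w \<in> carrier_vec m"
    and nondeg: "\<And>x. x \<in> carrier_vec m \<Longrightarrow> x \<noteq> 0\<^sub>v m \<Longrightarrow> \<exists>y\<in>carrier_vec m. x \<bullet> (P *\<^sub>v y) \<noteq> 0"
  shows "(kerdock_sum m P w \<kappa>)\<^sup>2 + (kerdock_sum m P w (\<kappa> - 1))\<^sup>2 = 2 ^ m"
proof -
  let ?V = "carrier_vec m :: bit vec set"
  define c where "c x = kerdock_form P w x + \<kappa>" for x
  define q where "q = kerdock_form P w"
  have c1: "kerdock_form P w x + (\<kappa> - 1) = c x - 1" for x
    by (simp add: c_def)
  have "(kerdock_sum m P w \<kappa>)\<^sup>2 + (kerdock_sum m P w (\<kappa> - 1))\<^sup>2 =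
      (\<Sum>x\<in>?V. \<Sum>y\<in>?V. re4 (c x) * re4 (c y) + re4 (c x - 1) * re4 (c y - 1))"
    unfolding kerdock_sum_def c1 c_def [symmetric]
    by (simp add: power2_eq_square sum_product sum.distrib)
  also have "\<dots> = (\<Sum>x\<in>?V. \<Sum>y\<in>?V. re4 (c x - c y))"
    by (simp only: re4_diff)
  \<comment> \<open>The order is exchanged so that the inner variable can be translated by the outer
    one.\<close>
  also have "\<dots> = (\<Sum>y\<in>?V. \<Sum>x\<in>?V. re4 (c x - c y))"
    by (rule sum.swap)
  also have "\<dots> = (\<Sum>y\<in>?V. \<Sum>d\<in>?V. re4 (c (d + y) - c y))"
    by (intro sum.cong [OF refl] sum.reindex_bij_betw [symmetric] bij_betw_add_bit_vec)
  also have "\<dots> = (\<Sum>y\<in>?V. \<Sum>d\<in>?V. (if d \<bullet> (P *\<^sub>v y) = 0 then 1 else - 1) * re4 (q d))"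
  proof (intro sum.cong [OF refl])
    fix y d :: "bit vec" assume yd: "y \<in> carrier_vec m" "d \<in> carrier_vec m"
    \<comment> \<open>The constant \<open>\<kappa>\<close> cancels in the difference, and so does
      the value of the form at \<open>y\<close> after polarization.\<close>
    have "(c (d + y) - c y) mod 4 = (q (d + y) mod 4 - q y) mod 4"
      by (simp add: c_def q_def mod_simps)
    also have "\<dots> = (q d + 2 * of_bit (d \<bullet> (P *\<^sub>v y))) mod 4"
      unfolding q_def kerdock_form_add [OF P w yd(2,1)] by (simp add: mod_simps)
    finally have "re4 (c (d + y) - c y) = re4 (q d + 2 * of_bit (d \<bullet> (P *\<^sub>v y)))"
      by (rule re4_mod)
    then show "re4 (c (d + y) - c y) = (if d \<bullet> (P *\<^sub>v y) = 0 then 1 else - 1) * re4 (q d)"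
      by (simp only: re4_add_even)
  qed
  also have "\<dots> = (\<Sum>d\<in>?V. (\<Sum>y\<in>?V. if d \<bullet> (P *\<^sub>v y) = 0 then 1 else - 1) * re4 (q d))"
    by (subst sum.swap) (simp only: sum_distrib_right)
  also have "\<dots> = (\<Sum>d\<in>?V. if d = 0\<^sub>v m then 2 ^ m else 0)"
  proof (rule sum.cong [OF refl])
    fix d :: "bit vec" assume d: "d \<in> carrier_vec m"
    show "(\<Sum>y\<in>?V. if d \<bullet> (P *\<^sub>v y) = 0 then 1 else - 1) * re4 (q d) =
        (if d = 0\<^sub>v m then 2 ^ m else 0)"
    proof (cases "d = 0\<^sub>v m")
      case True
      have carrier: "P *\<^sub>v y \<in> carrier_vec m" if "y \<in> carrier_vec m" for y
        using P(1) that by (rule mult_mat_vec_carrier)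
      have "q (0\<^sub>v m) = 0" unfolding q_def using P(1) w by (rule kerdock_form_0)
      then have "re4 (q d) = 1" using True by (simp add: re4_def)
      moreover have "(\<Sum>y\<in>?V. if d \<bullet> (P *\<^sub>v y) = 0 then 1 else - 1 :: int) = (\<Sum>y\<in>?V. 1)"
        using True carrier by (intro sum.cong [OF refl]) simp
      ultimately show ?thesis using True by (simp add: card_carrier_bit_vec)
    next
      case False
      from nondeg [OF d this] obtain y where y: "y \<in> carrier_vec m" "d \<bullet> (P *\<^sub>v y) \<noteq> 0" by blast
      have "d \<bullet> (P *\<^sub>v (y + z)) = d \<bullet> (P *\<^sub>v y) + d \<bullet> (P *\<^sub>v z)"
        if "y \<in> carrier_vec m" "z \<in> carrier_vec m" for y z
        using that d P(1) by (simp add: mult_add_distrib_mat_vec [of _ m m] scalar_prod_add_distrib [of _ m])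
      from sum_sign_linear [of m "\<lambda>y. d \<bullet> (P *\<^sub>v y)", OF this y] False show ?thesis by simp
    qed
  qed
  also have "\<dots> = 2 ^ m"
    by (simp add: finite_carrier_bit_vec)
  finally show ?thesis .
qed

text \<open>For odd \<open>m\<close> the norm is an odd power of 2, whose decomposition into two
  squares leaves only the sign of the real part open.\<close>

lemma kerdock_sum_cases:
  assumes "P \<in> carrier_mat m m" "transpose_mat P = P" "w \<in> carrier_vec m"
    and "\<And>x. x \<in> carrier_vec m \<Longrightarrow> x \<noteq> 0\<^sub>v m \<Longrightarrow> \<exists>y\<in>carrier_vec m. x \<bullet> (P *\<^sub>v y) \<noteq> 0"
    and "odd m"
  shows "kerdock_sum m P w \<kappa> = 2 ^ ((m - 1) div 2) \<or> kerdock_sum m P w \<kappa> = - (2 ^ ((m - 1) div 2))"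
proof -
  from \<open>odd m\<close> obtain k where k: "m = 2 * k + 1" by (rule oddE)
  from kerdock_sum_norm [OF assms(1-4)] have "(kerdock_sum m P w \<kappa>)\<^sup>2 = 2 ^ (2 * k)"
    by (intro sum_two_squares_odd_power) (simp add: k)
  also have "\<dots> = (2 ^ k)\<^sup>2" by (simp add: power_mult power_mult_distrib mult.commute)
  finally show ?thesis by (simp add: k power2_eq_iff)
qed

text \<open>Without the quadratic part the summand is the real part of \<open>i^\<kappa>\<close>
  times the sign given by \<open>w \<bullet> x\<close>, so orthogonality of characters
  applies.\<close>

lemma kerdock_sum_zero_mat:
  assumes "w \<in> carrier_vec m"
  shows "kerdock_sum m (0\<^sub>m m m) w \<kappa> = (if w = 0\<^sub>v m then 2 ^ m * re4 \<kappa> else 0)"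
proof -
  have "kerdock_form (0\<^sub>m m m) w x mod 4 = 2 * of_bit (w \<bullet> x) mod 4" if x: "x \<in> carrier_vec m" for x
  proof -
    have "int_mat (0\<^sub>m m m) = 0\<^sub>m m m" by (intro eq_matI) simp_all
    moreover have "even (int_vec w \<bullet> int_vec x - of_bit (w \<bullet> x))"
      unfolding of_int_bit_eq_0_iff [symmetric] of_int_diff of_int_of_bit
      using x assms by (subst of_int_scalar_prod_int_vec) simp_all
    then have "2 * (int_vec w \<bullet> int_vec x) mod 4 = 2 * of_bit (w \<bullet> x) mod 4" by presburger
    moreover have "0\<^sub>m m m *\<^sub>v int_vec x = 0\<^sub>v m"
      using x by (intro eq_vecI) (simp_all add: scalar_prod_def)
    ultimately show ?thesis using x by (simp add: kerdock_form_def del: Z2.bit_not_zero_iff)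
  qed
  then have form: "re4 (kerdock_form (0\<^sub>m m m) w x + \<kappa>) = re4 (\<kappa> + 2 * of_bit (w \<bullet> x))"
    if "x \<in> carrier_vec m" for x
    unfolding add.commute [of \<kappa>] using that by (intro re4_mod mod_add_cong refl)
  have "kerdock_sum m (0\<^sub>m m m) w \<kappa> =
      (\<Sum>x\<in>carrier_vec m. (if w \<bullet> x = 0 then 1 else - 1) * re4 \<kappa>)"
    unfolding kerdock_sum_def re4_add_even [symmetric] by (intro sum.cong [OF refl] form)
  also have "\<dots> = (\<Sum>x\<in>carrier_vec m. if w \<bullet> x = 0 then 1 else - 1) * re4 \<kappa>"
    by (simp only: sum_distrib_right)
  also have "\<dots> = (if w = 0\<^sub>v m then 2 ^ m * re4 \<kappa> else 0)"
  proof (cases "w = 0\<^sub>v m")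
    case True
    have "(\<Sum>x\<in>carrier_vec m. if w \<bullet> x = 0 then 1 else - 1 :: int) = (\<Sum>x\<in>(carrier_vec m :: bit vec set). 1)"
      using True by (intro sum.cong [OF refl]) simp
    then show ?thesis using True by (simp add: card_carrier_bit_vec)
  next
    case False
    then obtain i where i: "i < m" "w $ i \<noteq> 0" using assms by (metis carrier_vecD eq_vecI index_zero_vec)
    \<comment> \<open>The unit vector at a nonzero coordinate of \<open>w\<close> shows that the
      character is nontrivial.\<close>
    then have "w \<bullet> unit_vec m i \<noteq> 0" using assms by (simp add: scalar_prod_right_unit)
    from sum_sign_linear [of m "\<lambda>x. w \<bullet> x", OF _ unit_vec_carrier this] False assms
    show ?thesis by (simp add: scalar_prod_add_distrib [of _ m])
  qed
  finally show ?thesis .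
qed

section \<open>The extension field and the Kerdock set\<close>

text \<open>Unit vectors read off the entries. This supplies uniqueness for the definite
  descriptions of the matrices and reduces matrix identities to identities of forms.\<close>

lemma bilinear_ext:
  fixes A B :: "'b::semiring_1 mat"
  assumes "A \<in> carrier_mat m n" "B \<in> carrier_mat m n"
    and eq: "\<And>x y. x \<in> carrier_vec m \<Longrightarrow> y \<in> carrier_vec n \<Longrightarrow> x \<bullet> (A *\<^sub>v y) = x \<bullet> (B *\<^sub>v y)"
  shows "A = B"
proof (rule eq_matI)
  fix i j assume "i < dim_row B" "j < dim_col B"
  then have ij: "i < m" "j < n" using assms(2) by auto
  have entry: "unit_vec m i \<bullet> (C *\<^sub>v unit_vec n j) = C $$ (i, j)"
    if "C \<in> carrier_mat m n" for C :: "'b mat"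
    using that ij by (subst scalar_prod_left_unit) (auto simp: scalar_prod_right_unit)
  show "A $$ (i, j) = B $$ (i, j)"
    using eq [OF unit_vec_carrier [of m i] unit_vec_carrier [of n j]]
    unfolding entry [OF assms(1)] entry [OF assms(2)] .
qed (use assms in auto)

text \<open>Multiplication by a nonzero \<open>x\<close> permutes the nonzero elements; comparing
  their products shows that \<open>x\<close> to their number is 1.\<close>

lemma power_card_field:
  fixes x :: "'b::field"
  assumes fin: "finite (UNIV :: 'b set)"
  shows "x ^ card (UNIV :: 'b set) = x"
proof (cases "x = 0")
  case True
  then show ?thesis using fin by (simp add: finite_UNIV_card_ge_0)
next
  case False
  let ?U = "UNIV - {0 :: 'b}"
  have "bij_betw ((*) x) ?U ?U"
    using False by (intro bij_betw_byWitness [where f' = "\<lambda>y. y / x"]) auto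
  then have "\<Prod>?U = (\<Prod>y\<in>?U. x * y)"
    by (rule prod.reindex_bij_betw [where g = "\<lambda>y. y", symmetric])
  also have "\<dots> = x ^ card ?U * \<Prod>?U" by (simp add: prod.distrib)
  finally have "x ^ card ?U = 1" using fin by simp
  moreover have "card (UNIV :: 'b set) = Suc (card ?U)"
    using fin by (rule card.remove) simp
  then have "x ^ card (UNIV :: 'b set) = x * x ^ card ?U" by (simp only: power_Suc)
  ultimately show ?thesis by (simp only: mult_1_right)
qed

section \<open>The extension field and its coordinates\<close>

locale binary_field_extension =
  fixes f :: "bit poly" and \<alpha> :: "'a::field" and m :: nat
  assumes irreducible: "irreducible f"
    and degree_f: "degree f = m"
    and adjoins_root: "adjoins_root f \<alpha>"
begin

lemma CHAR_eq_2: "CHAR('a) = 2"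
  using adjoins_root by (simp add: adjoins_root_def)

lemma add_self_eq_0: "x + x = (0 :: 'a)"
proof -
  have "x + x = of_nat CHAR('a) * x" unfolding CHAR_eq_2 by simp
  then show ?thesis by (simp only: of_nat_CHAR mult_zero_left)
qed

lemmas of_bit_hom =
  of_bit_mult [where 'a = 'a] of_bit_add_char2 [OF CHAR_eq_2] of_bit_sum_char2 [OF CHAR_eq_2]

lemma degree_pos: "m > 0"
proof (rule ccontr)
  assume "\<not> m > 0"
  then have "degree f = 0" using degree_f by simp
  then have "f = 0 \<or> is_unit f"
    by (auto elim!: degree_eq_zeroE simp: is_unit_const_poly_iff dvd_field_iff)
  then show False using irreducible by (auto simp: irreducible_def)
qed

text \<open>The ring homomorphism from the polynomials over \<open>bit\<close> onto the field, with
  \<open>f\<close> in its kernel.\<close>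

definition ev :: "bit poly \<Rightarrow> 'a" where
  "ev q = poly (map_poly of_bit q) \<alpha>"

lemma ev_0: "ev 0 = 0"
  by (simp add: ev_def)

lemma ev_f: "ev f = 0"
  using adjoins_root by (simp add: ev_def adjoins_root_def)

lemma ev_surj: "\<exists>q. x = ev q"
  using adjoins_root by (simp add: ev_def adjoins_root_def)

lemma ev_pCons: "ev (pCons a q) = of_bit a + \<alpha> * ev q"
  by (simp add: ev_def map_poly_pCons)

lemma ev_add: "ev (p + q) = ev p + ev q"
proof -
  have "map_poly of_bit (p + q) = map_poly of_bit p + (map_poly of_bit q :: 'a poly)"
  proof (rule poly_eqI)
    fix n
    have coeff: "coeff (map_poly of_bit r :: 'a poly) n = of_bit (coeff r n)" for r
      by (simp add: coeff_map_poly)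
    show "coeff (map_poly of_bit (p + q) :: 'a poly) n = coeff (map_poly of_bit p + map_poly of_bit q) n"
      unfolding coeff_add coeff of_bit_hom ..
  qed
  then show ?thesis by (simp only: ev_def poly_add)
qed

lemma ev_mult: "ev (p * q) = ev p * ev q"
proof (induction p)
  case 0
  then show ?case by (simp add: ev_0)
next
  case (pCons a p)
  have "ev (smult a q) = of_bit a * ev q"
    by (cases a) (simp_all add: ev_0)
  moreover have "ev (pCons 0 (p * q)) = \<alpha> * (ev p * ev q)"
    by (simp add: ev_pCons pCons.IH)
  ultimately show ?case
    unfolding mult_pCons_left ev_add ev_pCons by (simp only: distrib_right mult.assoc)
qed

lemma ev_sum: "ev (sum g S) = (\<Sum>i\<in>S. ev (g i))"
  by (induction S rule: infinite_finite_induct) (simp_all add: ev_0 ev_add)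

lemma ev_monom: "ev (monom c n) = of_bit c * \<alpha> ^ n"
  by (simp add: ev_def map_poly_monom poly_monom)

lemma ev_mod: "ev (p mod g) = ev p" if "ev g = 0"
proof -
  have "ev p = ev (p div g * g + p mod g)" by simp
  also have "\<dots> = ev (p mod g)" using that by (simp only: ev_add ev_mult mult_zero_right add_0)
  finally show ?thesis ..
qed

text \<open>A nonzero polynomial \<open>h\<close> of least degree in the kernel divides
  \<open>f\<close>, since the remainder also lies in the kernel. As \<open>f\<close> is irreducible
  and \<open>h\<close> is no unit, both have the same degree.\<close>

lemma degree_ge_if_ev_eq_0:
  assumes "ev g = 0" "g \<noteq> 0"
  shows "m \<le> degree g"
proof -
  let ?K = "\<lambda>g. ev g = 0 \<and> g \<noteq> 0"
  obtain h where h: "ev h = 0" "h \<noteq> 0" and least: "\<And>g. ?K g \<Longrightarrow> degree h \<le> degree g"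
    using ex_has_least_nat [of ?K g degree] assms by blast
  have "ev (f mod h) = 0" using ev_mod [OF h(1)] ev_f by simp
  moreover have "f mod h = 0 \<or> degree (f mod h) < degree h"
    using h(2) by (rule degree_mod_less)
  ultimately have "f mod h = 0" using least [of "f mod h"] by force
  then obtain r where r: "f = h * r" by (auto elim!: dvdE)
  have "\<not> is_unit h"
  proof
    assume "is_unit h"
    then obtain c where "h = [:c:]" by (rule is_unit_polyE)
    then show False using h by (simp add: ev_pCons ev_0)
  qed
  then have "is_unit r" using irreducible r by (auto dest: irreducibleD)
  then have "degree f = degree h"
    using h(2) r by (auto elim!: is_unit_polyE)
  then show ?thesis using least [of g] assms degree_f by simp
qed

definition vec_poly :: "bit vec \<Rightarrow> bit poly" where
  "vec_poly z = (\<Sum>i<m. monom (z $ i) i)"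

lemma coeff_vec_poly: "coeff (vec_poly z) n = (if n < m then z $ n else 0)"
  by (simp add: vec_poly_def coeff_sum if_distrib sum.delta cong: if_cong)

lemma ev_vec_poly: "z \<in> carrier_vec m \<Longrightarrow> ev (vec_poly z) = field_elem \<alpha> z"
  by (simp add: vec_poly_def ev_sum ev_monom field_elem_def)

lemma field_elem_add:
  assumes "x \<in> carrier_vec m" "y \<in> carrier_vec m"
  shows "field_elem \<alpha> (x + y) = field_elem \<alpha> x + field_elem \<alpha> y"
proof -
  have "of_bit ((x + y) $ i) * \<alpha> ^ i = of_bit (x $ i) * \<alpha> ^ i + of_bit (y $ i) * \<alpha> ^ i"
    if "i < m" for i
  proof -
    have "(x + y) $ i = x $ i + y $ i" using assms that by simp
    then show ?thesis by (simp only: of_bit_hom distrib_right)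
  qed
  moreover have "dim_vec (x + y) = m" "dim_vec x = m" "dim_vec y = m" using assms by auto
  ultimately show ?thesis by (simp add: field_elem_def flip: sum.distrib)
qed

text \<open>Linear independence of the powers of \<alpha> below \<open>m\<close>: a nonzero relation
  would be a kernel polynomial of degree less than \<open>m\<close>.\<close>

lemma field_elem_eq_0_iff:
  assumes "z \<in> carrier_vec m"
  shows "field_elem \<alpha> z = 0 \<longleftrightarrow> z = 0\<^sub>v m"
proof
  assume "field_elem \<alpha> z = 0"
  then have "ev (vec_poly z) = 0" using assms by (simp add: ev_vec_poly)
  moreover have "degree (vec_poly z) < m"
    using degree_pos by (intro degree_lessI) (auto simp: coeff_vec_poly)
  ultimately have "vec_poly z = 0" using degree_ge_if_ev_eq_0 [of "vec_poly z"] by linarith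
  then have "z $ i = 0" if "i < m" for i using coeff_vec_poly [of z i] that by simp
  then show "z = 0\<^sub>v m" using assms by (intro eq_vecI) auto
qed (simp add: field_elem_def)

text \<open>These powers form a basis: independence, applied to \<open>x + y\<close> in
  characteristic 2, gives injectivity, and reduction modulo \<open>f\<close> gives
  surjectivity.\<close>

lemma field_elem_bij: "bij_betw (field_elem \<alpha>) (carrier_vec m) UNIV"
proof (rule bij_betw_imageI)
  show "inj_on (field_elem \<alpha>) (carrier_vec m)"
  proof (rule inj_onI)
    fix x y :: "bit vec"
    assume xy: "x \<in> carrier_vec m" "y \<in> carrier_vec m" "field_elem \<alpha> x = field_elem \<alpha> y"
    then have "x + y = 0\<^sub>v m"
      using field_elem_eq_0_iff [of "x + y"] by (simp add: field_elem_add add_self_eq_0)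
    moreover have "(x + y) + y = x"
      using xy by (simp add: assoc_add_vec [of _ m] bit_vec_add_self [of _ m])
    ultimately show "x = y" using xy by simp
  qed
  show "field_elem \<alpha> ` carrier_vec m = UNIV"
  proof (intro equalityI subset_UNIV subsetI)
    fix x :: 'a
    obtain q where q: "x = ev q" using ev_surj by blast
    define r where "r = q mod f"
    have "f \<noteq> 0" using degree_f degree_pos by auto
    then have "degree r < m"
      using degree_mod_less [of f q] degree_f degree_pos by (auto simp: r_def)
    then have "r = vec_poly (vec m (coeff r))"
      by (intro poly_eqI) (auto simp: coeff_vec_poly coeff_eq_0)
    moreover have "x = ev r" using q ev_mod [OF ev_f] by (simp add: r_def)
    ultimately have "x = field_elem \<alpha> (vec m (coeff r))" using ev_vec_poly [of "vec m (coeff r)"] by simp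
    then show "x \<in> field_elem \<alpha> ` carrier_vec m" by auto
  qed
qed

lemma field_elem_inj:
  "field_elem \<alpha> x = field_elem \<alpha> y \<longleftrightarrow> x = y" if "x \<in> carrier_vec m" "y \<in> carrier_vec m"
  using bij_betw_imp_inj_on [OF field_elem_bij] that by (rule inj_on_eq_iff)

lemma field_elem_surj: obtains x where "x \<in> carrier_vec m" "field_elem \<alpha> x = y"
  using bij_betw_imp_surj_on [OF field_elem_bij] by (metis UNIV_I imageE)

lemma finite_UNIV: "finite (UNIV :: 'a set)"
  using bij_betw_finite [OF field_elem_bij] finite_carrier_bit_vec by blast

lemma card_UNIV_eq: "card (UNIV :: 'a set) = 2 ^ m"
  using bij_betw_same_card [OF field_elem_bij] card_carrier_bit_vec by simp

lemma power_2_power: "x ^ (2 ^ m) = (x :: 'a)"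
  using power_card_field [OF finite_UNIV] by (simp add: card_UNIV_eq)

section \<open>The trace map and the matrices of trace form and multiplication\<close>

abbreviation "Tr \<equiv> field_trace m :: 'a \<Rightarrow> 'a"

lemma Tr_add: "Tr (x + y) = Tr x + Tr y"
proof -
  have "(x + y) ^ (2 ^ i) = x ^ (2 ^ i) + y ^ (2 ^ i)" for i
    by (rule freshmans_dream' [of _ i]) (simp_all add: CHAR_eq_2)
  then show ?thesis by (simp add: field_trace_def sum.distrib)
qed

lemma Tr_0: "Tr 0 = 0"
  by (simp add: field_trace_def power_0_left)

lemma Tr_sum: "Tr (sum g S) = (\<Sum>i\<in>S. Tr (g i))"
  by (induction S rule: infinite_finite_induct) (simp_all add: Tr_0 Tr_add)

lemma Tr_of_bit_mult: "Tr (of_bit b * x) = of_bit b * Tr x"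
  by (cases b) (simp_all add: Tr_0)

text \<open>Squaring shifts the conjugates of \<open>x\<close> cyclically, the last one returning to
  \<open>x\<close>.\<close>

lemma Tr_square: "Tr (x\<^sup>2) = Tr x"
proof -
  obtain k where k: "m = Suc k" using degree_pos by (cases m) auto
  have "Tr (x\<^sup>2) = (\<Sum>i<m. x ^ (2 ^ Suc i))"
    by (simp add: field_trace_def power_mult)
  also have "\<dots> = (\<Sum>i<k. x ^ (2 ^ Suc i)) + x ^ (2 ^ m)"
    by (simp add: k)
  also have "\<dots> = x ^ (2 ^ 0) + (\<Sum>i<k. x ^ (2 ^ Suc i))"
    by (simp add: power_2_power)
  also have "\<dots> = Tr x"
    unfolding field_trace_def k by (rule sum.lessThan_Suc_shift [symmetric])
  finally show ?thesis .
qed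

text \<open>By additivity of squaring, the trace equals its own square.\<close>

lemma Tr_cases: "Tr x = 0 \<or> Tr x = 1"
proof -
  have "(Tr x)\<^sup>2 = (\<Sum>i<m. (x ^ (2 ^ i))\<^sup>2)"
    unfolding field_trace_def by (rule freshmans_dream_sum) (simp_all add: CHAR_eq_2)
  also have "\<dots> = Tr (x\<^sup>2)"
    by (simp add: field_trace_def mult.commute flip: power_mult)
  also have "\<dots> = Tr x" by (rule Tr_square)
  finally have "Tr x * (Tr x - 1) = 0" by (simp add: power2_eq_square algebra_simps)
  then show ?thesis by simp
qed

text \<open>The trace is a nonzero polynomial function of degree at most \<open>2 ^ (m - 1)\<close>,
  too small for all \<open>2 ^ m\<close> elements to be roots.\<close>

lemma Tr_nonzero: "\<exists>x. Tr x \<noteq> 0"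
proof (rule ccontr)
  assume "\<nexists>x. Tr x \<noteq> 0"
  define p :: "'a poly" where "p = (\<Sum>i<m. monom 1 (2 ^ i))"
  have "poly p x = Tr x" for x
    by (simp add: p_def poly_sum poly_monom field_trace_def)
  then have roots: "{x. poly p x = 0} = UNIV" using \<open>\<nexists>x. Tr x \<noteq> 0\<close> by auto
  \<comment> \<open>Only the top summand contributes to this coefficient, which shows that
    \<open>p\<close> is nonzero.\<close>
  have "coeff p (2 ^ (m - 1)) = (\<Sum>i<m. if i = m - 1 then 1 else 0)"
    by (simp add: p_def coeff_sum)
  also have "\<dots> = 1" using degree_pos by simp
  finally have "p \<noteq> 0" by auto
  then have "card (UNIV :: 'a set) \<le> degree p" using card_poly_roots_bound [of p] roots by simp
  moreover have "degree p \<le> 2 ^ (m - 1)"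
    unfolding p_def
    by (intro degree_sum_le finite_lessThan order.trans [OF degree_monom_le] power_increasing) auto
  moreover have "(2 :: nat) ^ (m - 1) < 2 ^ m" using degree_pos by simp
  ultimately show False by (simp add: card_UNIV_eq)
qed

lemma Tr_nondegenerate:
  assumes "z \<noteq> 0"
  shows "\<exists>y. Tr (z * y) \<noteq> 0"
proof -
  obtain x where "Tr x \<noteq> 0" using Tr_nonzero by blast
  then show ?thesis using assms by (intro exI [of _ "x / z"]) simp
qed

text \<open>Unfolds the definite description: the Gram matrix of the trace form in the basis of
  powers of \<alpha> is a witness, and a matrix is determined by its bilinear form.\<close>

lemma trace_mat:
  shows trace_mat_carrier: "trace_mat \<alpha> m \<in> carrier_mat m m"
    and trace_mat_form: "x \<in> carrier_vec m \<Longrightarrow> y \<in> carrier_vec m \<Longrightarrow>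
      of_bit (x \<bullet> (trace_mat \<alpha> m *\<^sub>v y)) = Tr (field_elem \<alpha> x * field_elem \<alpha> y)"
proof -
  let ?P = "\<lambda>W. W \<in> carrier_mat m m \<and> transpose_mat W = W \<and>
     (\<forall>x\<in>carrier_vec m. \<forall>y\<in>carrier_vec m.
        Tr (field_elem \<alpha> x * field_elem \<alpha> y) = of_bit (x \<bullet> (W *\<^sub>v y)))"
  \<comment> \<open>Traces lie in the copy of \<open>bit\<close> inside the field, so testing for 0
    pulls them back to bits.\<close>
  define W where "W = mat m m (\<lambda>(i, j). if Tr (\<alpha> ^ i * \<alpha> ^ j) = 0 then 0 else (1 :: bit))"
  have entry: "of_bit (W $$ (i, j)) = Tr (\<alpha> ^ i * \<alpha> ^ j)" if "i < m" "j < m" for i j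
    using that Tr_cases [of "\<alpha> ^ i * \<alpha> ^ j"] by (auto simp: W_def)
  have "Tr (field_elem \<alpha> x * field_elem \<alpha> y) = of_bit (x \<bullet> (W *\<^sub>v y))"
    if "x \<in> carrier_vec m" "y \<in> carrier_vec m" for x y
  proof -
    have "Tr (field_elem \<alpha> x * field_elem \<alpha> y) =
        Tr (\<Sum>i<m. \<Sum>j<m. of_bit (x $ i) * (of_bit (y $ j) * (\<alpha> ^ i * \<alpha> ^ j)))"
      unfolding field_elem_def carrier_vecD [OF that(1)] carrier_vecD [OF that(2)] sum_product
      by (simp only: ac_simps)
    also have "\<dots> = (\<Sum>i<m. \<Sum>j<m. of_bit (x $ i) * (of_bit (y $ j) * Tr (\<alpha> ^ i * \<alpha> ^ j)))"
      by (simp only: Tr_sum Tr_of_bit_mult)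
    also have "\<dots> = (\<Sum>i<m. \<Sum>j<m. of_bit (x $ i) * (of_bit (W $$ (i, j)) * of_bit (y $ j)))"
      by (intro sum.cong refl) (simp only: entry lessThan_iff ac_simps)
    also have "\<dots> = of_bit (\<Sum>i<m. x $ i * (\<Sum>j<m. W $$ (i, j) * y $ j))"
      by (simp only: of_bit_hom sum_distrib_left)
    also have "(\<Sum>i<m. x $ i * (\<Sum>j<m. W $$ (i, j) * y $ j)) = x \<bullet> (W *\<^sub>v y)"
      using that by (simp add: scalar_prod_def W_def lessThan_atLeast0)
    finally show ?thesis .
  qed
  moreover have "transpose_mat W = W"
    by (intro eq_matI) (auto simp: W_def mult.commute)
  ultimately have "?P W" by (simp add: W_def)
  moreover have "W' = W''" if "?P W'" "?P W''" for W' W''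
  proof (rule bilinear_ext [of _ m m])
    fix x y :: "bit vec" assume "x \<in> carrier_vec m" "y \<in> carrier_vec m"
    with that have "of_bit (x \<bullet> (W' *\<^sub>v y)) = (of_bit (x \<bullet> (W'' *\<^sub>v y)) :: 'a)" by metis
    then show "x \<bullet> (W' *\<^sub>v y) = x \<bullet> (W'' *\<^sub>v y)" unfolding of_bit_inject .
  qed (use that in auto)
  ultimately have "?P (trace_mat \<alpha> m)"
    unfolding trace_mat_def by (intro theI [of ?P W]) blast+
  then show "trace_mat \<alpha> m \<in> carrier_mat m m"
    and "x \<in> carrier_vec m \<Longrightarrow> y \<in> carrier_vec m \<Longrightarrow>
      of_bit (x \<bullet> (trace_mat \<alpha> m *\<^sub>v y)) = Tr (field_elem \<alpha> x * field_elem \<alpha> y)"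
    by (simp_all only:)
qed

text \<open>Existence follows by expanding in the basis of powers of \<alpha>; uniqueness holds
  because \<open>field_elem\<close> is injective on coordinate vectors.\<close>

lemma mult_mat:
  shows mult_mat_carrier: "mult_mat \<alpha> m z \<in> carrier_mat m m"
    and field_elem_mult_mat: "x \<in> carrier_vec m \<Longrightarrow>
      field_elem \<alpha> (transpose_mat (mult_mat \<alpha> m z) *\<^sub>v x) = field_elem \<alpha> x * z"
proof -
  let ?P = "\<lambda>A. A \<in> carrier_mat m m \<and>
     (\<forall>x\<in>carrier_vec m. field_elem \<alpha> (transpose_mat A *\<^sub>v x) = field_elem \<alpha> x * z)"
  \<comment> \<open>The coordinates of \<open>\<alpha> ^ i * z\<close> form row \<open>i\<close> of
    the matrix, since vectors act from the left as rows.\<close>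
  define r where "r i = inv_into (carrier_vec m) (field_elem \<alpha>) (\<alpha> ^ i * z)" for i
  have "\<alpha> ^ i * z \<in> field_elem \<alpha> ` carrier_vec m" for i
    by (simp add: bij_betw_imp_surj_on [OF field_elem_bij])
  then have r: "r i \<in> carrier_vec m" "field_elem \<alpha> (r i) = \<alpha> ^ i * z" for i
    unfolding r_def by (rule inv_into_into, rule f_inv_into_f)
  define A where "A = mat m m (\<lambda>(i, j). r i $ j)"
  have "field_elem \<alpha> (transpose_mat A *\<^sub>v x) = field_elem \<alpha> x * z" if "x \<in> carrier_vec m" for x
  proof -
    have "(transpose_mat A *\<^sub>v x) $ j = (\<Sum>i<m. x $ i * r i $ j)" if "j < m" for j
      using that \<open>x \<in> carrier_vec m\<close>
      by (auto simp: A_def scalar_prod_def lessThan_atLeast0 mult.commute intro!: sum.cong)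
    note entry = this
    have dim: "dim_vec (transpose_mat A *\<^sub>v x) = m" by (simp add: A_def)
    have "field_elem \<alpha> (transpose_mat A *\<^sub>v x) =
        (\<Sum>j<m. of_bit (\<Sum>i<m. x $ i * r i $ j) * \<alpha> ^ j)"
      unfolding field_elem_def dim by (intro sum.cong refl) (simp only: entry lessThan_iff)
    also have "\<dots> = (\<Sum>j<m. \<Sum>i<m. of_bit (x $ i) * (of_bit (r i $ j) * \<alpha> ^ j))"
      by (simp only: of_bit_hom sum_distrib_right mult.assoc)
    also have "\<dots> = (\<Sum>i<m. of_bit (x $ i) * (\<Sum>j<m. of_bit (r i $ j) * \<alpha> ^ j))"
      by (subst sum.swap) (simp only: sum_distrib_left)
    also have "\<dots> = (\<Sum>i<m. of_bit (x $ i) * (\<alpha> ^ i * z))"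
      unfolding r(2) [symmetric] field_elem_def carrier_vecD [OF r(1)] ..
    also have "\<dots> = field_elem \<alpha> x * z"
      unfolding field_elem_def carrier_vecD [OF that] by (simp only: sum_distrib_right mult.assoc)
    finally show ?thesis .
  qed
  then have "?P A" by (simp add: A_def)
  moreover have "B = C" if B: "?P B" and C: "?P C" for B C
  proof -
    have Bt: "transpose_mat B \<in> carrier_mat m m" and Ct: "transpose_mat C \<in> carrier_mat m m"
      using B C by auto
    have "transpose_mat B = transpose_mat C"
    proof (rule bilinear_ext [OF Bt Ct])
      fix x y :: "bit vec" assume "x \<in> carrier_vec m" and y: "y \<in> carrier_vec m"
      have "field_elem \<alpha> (transpose_mat B *\<^sub>v y) = field_elem \<alpha> (transpose_mat C *\<^sub>v y)"
        using B C y by simp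
      then have "transpose_mat B *\<^sub>v y = transpose_mat C *\<^sub>v y"
        using field_elem_inj [OF mult_mat_vec_carrier [OF Bt y] mult_mat_vec_carrier [OF Ct y]] by blast
      then show "x \<bullet> (transpose_mat B *\<^sub>v y) = x \<bullet> (transpose_mat C *\<^sub>v y)" by simp
    qed
    then show ?thesis by (metis transpose_transpose)
  qed
  ultimately have "?P (mult_mat \<alpha> m z)"
    unfolding mult_mat_def by (intro theI [of ?P A]) blast+
  then show "mult_mat \<alpha> m z \<in> carrier_mat m m"
    and "x \<in> carrier_vec m \<Longrightarrow>
      field_elem \<alpha> (transpose_mat (mult_mat \<alpha> m z) *\<^sub>v x) = field_elem \<alpha> x * z"
    by (simp_all only:)
qed

section \<open>The Kerdock matrices\<close>

definition kerdock_mat :: "'a \<Rightarrow> bit mat" where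
  "kerdock_mat z = mult_mat \<alpha> m z * trace_mat \<alpha> m"

lemma kerdock_mat_carrier: "kerdock_mat z \<in> carrier_mat m m"
  unfolding kerdock_mat_def using mult_mat_carrier trace_mat_carrier by (rule mult_carrier_mat)

text \<open>Moving the multiplication matrix to the other side of the scalar product multiplies
  \<open>x\<close> by \<open>z\<close>. The properties of these matrices below all rest on this
  trace formula.\<close>

lemma kerdock_mat_form:
  assumes x: "x \<in> carrier_vec m" and y: "y \<in> carrier_vec m"
  shows "of_bit (x \<bullet> (kerdock_mat z *\<^sub>v y)) = Tr (z * field_elem \<alpha> x * field_elem \<alpha> y)"
proof -
  let ?A = "mult_mat \<alpha> m z" and ?W = "trace_mat \<alpha> m"
  note A = mult_mat_carrier [of z] and W = trace_mat_carrier
  have Wy: "?W *\<^sub>v y \<in> carrier_vec m" using W y by (rule mult_mat_vec_carrier)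
  have Ax: "transpose_mat ?A *\<^sub>v x \<in> carrier_vec m"
    by (rule mult_mat_vec_carrier [of _ m m]) (use A x in auto)
  have "x \<bullet> (kerdock_mat z *\<^sub>v y) = x \<bullet> (?A *\<^sub>v (?W *\<^sub>v y))"
    unfolding kerdock_mat_def assoc_mult_mat_vec [OF A W y] ..
  also have "\<dots> = (transpose_mat ?A *\<^sub>v x) \<bullet> (?W *\<^sub>v y)"
    using transpose_vec_mult_scalar [OF A Wy x] by simp
  finally have "of_bit (x \<bullet> (kerdock_mat z *\<^sub>v y)) =
      Tr (field_elem \<alpha> (transpose_mat ?A *\<^sub>v x) * field_elem \<alpha> y)"
    using trace_mat_form [OF Ax y] by (simp only:)
  then show ?thesis unfolding field_elem_mult_mat [OF x] by (simp only: mult.commute)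
qed

lemma kerdock_mat_symmetric: "transpose_mat (kerdock_mat z) = kerdock_mat z"
proof (rule bilinear_ext [of _ m m])
  fix x y :: "bit vec" assume x: "x \<in> carrier_vec m" and y: "y \<in> carrier_vec m"
  let ?P = "kerdock_mat z"
  note P = kerdock_mat_carrier [of z]
  have "x \<bullet> (transpose_mat ?P *\<^sub>v y) = (transpose_mat ?P *\<^sub>v y) \<bullet> x"
    by (rule comm_scalar_prod [OF x]) (rule mult_mat_vec_carrier [of _ m m], use P y in auto)
  also have "\<dots> = y \<bullet> (?P *\<^sub>v x)"
    by (rule transpose_vec_mult_scalar [OF P x y])
  also have "\<dots> = x \<bullet> (?P *\<^sub>v y)"
    unfolding of_bit_inject [where 'a = 'a, symmetric] kerdock_mat_form [OF x y] kerdock_mat_form [OF y x]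
    by (simp only: ac_simps)
  finally show "x \<bullet> (transpose_mat ?P *\<^sub>v y) = x \<bullet> (?P *\<^sub>v y)" .
qed (use kerdock_mat_carrier in auto)

lemma kerdock_mat_0: "kerdock_mat 0 = 0\<^sub>m m m"
proof (rule bilinear_ext [OF kerdock_mat_carrier])
  fix x y :: "bit vec" assume x: "x \<in> carrier_vec m" and y: "y \<in> carrier_vec m"
  have "0\<^sub>m m m *\<^sub>v y = 0\<^sub>v m" using y by (intro eq_vecI) (simp_all add: scalar_prod_def)
  moreover have "x \<bullet> (kerdock_mat 0 *\<^sub>v y) = 0"
    unfolding of_bit_inject [where 'a = 'a, symmetric] kerdock_mat_form [OF x y] by (simp add: Tr_0)
  ultimately show "x \<bullet> (kerdock_mat 0 *\<^sub>v y) = x \<bullet> (0\<^sub>m m m *\<^sub>v y)" using x by simp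
qed simp

text \<open>The product of \<open>z\<close> and the element of \<open>x\<close> is nonzero, so some
  element pairs with it to a nonzero trace, and \<open>y\<close> is the coordinate vector of that
  element.\<close>

lemma kerdock_mat_nondegenerate:
  assumes "z \<noteq> 0" "x \<in> carrier_vec m" "x \<noteq> 0\<^sub>v m"
  shows "\<exists>y\<in>carrier_vec m. x \<bullet> (kerdock_mat z *\<^sub>v y) \<noteq> 0"
proof -
  have "z * field_elem \<alpha> x \<noteq> 0" using assms by (simp add: field_elem_eq_0_iff)
  then obtain s where "Tr (z * field_elem \<alpha> x * s) \<noteq> 0" using Tr_nondegenerate by blast
  moreover obtain y where y: "y \<in> carrier_vec m" "field_elem \<alpha> y = s" by (rule field_elem_surj)
  ultimately have "of_bit (x \<bullet> (kerdock_mat z *\<^sub>v y)) \<noteq> (0 :: 'a)"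
    using kerdock_mat_form [OF assms(2) y(1)] by simp
  then show ?thesis using y(1) by (intro bexI [of _ y]) (cases "x \<bullet> (kerdock_mat z *\<^sub>v y)", simp_all)
qed

text \<open>The diagonal values are the traces of \<open>z\<close> times a square. Every element is
  a square in this field, so they determine the whole functional and hence \<open>z\<close>.\<close>

lemma kerdock_mat_eqI:
  assumes "\<And>x. x \<in> carrier_vec m \<Longrightarrow> x \<bullet> (kerdock_mat z *\<^sub>v x) = x \<bullet> (kerdock_mat z' *\<^sub>v x)"
  shows "z = z'"
proof (rule ccontr)
  assume "z \<noteq> z'"
  then obtain s where s: "Tr ((z - z') * s) \<noteq> 0" using Tr_nondegenerate [of "z - z'"] by auto
  \<comment> \<open>This power is the square root of \<open>s\<close>, because
    \<open>s ^ (2 ^ m) = s\<close>.\<close>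
  obtain x where x: "x \<in> carrier_vec m" "field_elem \<alpha> x = s ^ (2 ^ (m - 1))" by (rule field_elem_surj)
  have sq: "field_elem \<alpha> x * field_elem \<alpha> x = s"
  proof -
    have "field_elem \<alpha> x * field_elem \<alpha> x = s ^ (2 ^ (m - 1) + 2 ^ (m - 1))"
      by (simp add: x(2) power_add)
    also have "(2 :: nat) ^ (m - 1) + 2 ^ (m - 1) = 2 ^ m"
      using degree_pos by (cases m) simp_all
    finally show ?thesis by (simp add: power_2_power)
  qed
  have "Tr (z * s) = of_bit (x \<bullet> (kerdock_mat z *\<^sub>v x))" "Tr (z' * s) = of_bit (x \<bullet> (kerdock_mat z' *\<^sub>v x))"
    unfolding kerdock_mat_form [OF x(1) x(1)] mult.assoc sq by simp_all
  then have "Tr (z * s) = Tr (z' * s)" using assms [OF x(1)] by simp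
  moreover have "Tr (z * s) = Tr ((z - z') * s) + Tr (z' * s)"
    by (simp add: algebra_simps flip: Tr_add)
  ultimately show False using s by simp
qed

end

section \<open>Counting codewords\<close>

context binary_field_extension
begin

section \<open>Codewords and their parameters\<close>

definition codeword :: "bit vec list \<Rightarrow> 'a \<Rightarrow> bit vec \<Rightarrow> int \<Rightarrow> bit list" where
  "codeword xs z w \<kappa> = gray_map (map (\<lambda>x. (kerdock_form (kerdock_mat z) w x + \<kappa>) mod 4) xs)"

abbreviation params :: "('a \<times> bit vec \<times> int) set" where
  "params \<equiv> UNIV \<times> carrier_vec m \<times> {0, 1, 2, 3}"

lemma binary_kerdock_code_eq:
  "binary_kerdock_code \<alpha> m xs = (\<lambda>(z, w, \<kappa>). codeword xs z w \<kappa>) ` params"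
  unfolding binary_kerdock_code_def kerdock_code_Z4_def kerdock_set_def codeword_def kerdock_form_def
    kerdock_mat_def Let_def
  by (fastforce simp only: image_iff mem_Collect_eq split: prod.split)

text \<open>The parameters are recovered in turn: \<open>\<kappa>\<close> from the value at the zero
  vector, \<open>z\<close> from the parities of the form, and \<open>w\<close> from the values at
  unit vectors.\<close>

lemma inj_codeword:
  assumes "set xs = carrier_vec m"
  shows "inj_on (\<lambda>(z, w, \<kappa>). codeword xs z w \<kappa>) params"
proof -
  have "z = z' \<and> w = w' \<and> \<kappa> = \<kappa>'"
    if eq: "codeword xs z w \<kappa> = codeword xs z' w' \<kappa>'"
      and w: "w \<in> carrier_vec m" "w' \<in> carrier_vec m" and \<kappa>: "\<kappa> \<in> {0, 1, 2, 3}" "\<kappa>' \<in> {0, 1, 2, 3}"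
    for z w \<kappa> z' w' \<kappa>'
  proof -
    let ?c = "\<lambda>z w \<kappa> x. (kerdock_form (kerdock_mat z) w x + \<kappa>) mod 4"
    have range: "set (map (?c z w \<kappa>) xs) \<subseteq> {0, 1, 2, 3}" for z w \<kappa> by auto
    have "map (?c z w \<kappa>) xs = map (?c z' w' \<kappa>') xs"
      using inj_onD [OF inj_gray_map eq [unfolded codeword_def]] range by blast
    then have c: "?c z w \<kappa> x = ?c z' w' \<kappa>' x" if "x \<in> carrier_vec m" for x
      using that assms by simp
    have "\<kappa> mod 4 = \<kappa>' mod 4"
      using c [of "0\<^sub>v m"] by (simp add: kerdock_form_0 [OF kerdock_mat_carrier] w)
    then have \<kappa>_eq: "\<kappa> = \<kappa>'" using \<kappa> by auto
    have form: "kerdock_form (kerdock_mat z) w x mod 4 = kerdock_form (kerdock_mat z') w' x mod 4"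
      if "x \<in> carrier_vec m" for x
      using mod_diff_cong [OF c [OF that] refl [of "\<kappa>' mod 4"]]
      by (simp add: \<kappa>_eq)
    \<comment> \<open>Modulo 2 the linear part disappears, leaving the diagonal of the bilinear
      form.\<close>
    have of_int_form: "of_int (kerdock_form (kerdock_mat z) w x) = x \<bullet> (kerdock_mat z *\<^sub>v x)"
      if "x \<in> carrier_vec m" for z w x
      unfolding kerdock_form_def of_int_add
      using of_int_bilinear_int_vec [OF that that kerdock_mat_carrier [of z]]
      by (simp only: of_int_mult of_int_numeral bit_2_eq_0 mult_zero_left add_0_right)
    have "z = z'"
    proof (rule kerdock_mat_eqI)
      fix x :: "bit vec" assume x: "x \<in> carrier_vec m"
      have "even (kerdock_form (kerdock_mat z) w x - kerdock_form (kerdock_mat z') w' x)"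
        using form [OF x] by presburger
      then show "x \<bullet> (kerdock_mat z *\<^sub>v x) = x \<bullet> (kerdock_mat z' *\<^sub>v x)"
        unfolding of_int_bit_eq_0_iff [symmetric] of_int_diff of_int_form [OF x] by (simp only: right_minus_eq)
    qed
    moreover have "w = w'"
    proof (rule eq_vecI)
      fix i assume "i < dim_vec w'"
      then have i: "i < m" using w by simp
      let ?e = "unit_vec m i :: bit vec"
      \<comment> \<open>With the quadratic parts equal, agreement modulo 4 of the doubled linear
        parts means agreement modulo 2 of the linear parts.\<close>
      have "even (a - b)" if "(q + 2 * a) mod 4 = (q + 2 * b) mod 4" for q a b :: int
        using that by presburger
      then have "even (int_vec w \<bullet> int_vec ?e - int_vec w' \<bullet> int_vec ?e)"
        using form [OF unit_vec_carrier] unfolding \<open>z = z'\<close> kerdock_form_def by blast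
      then have "w \<bullet> ?e = w' \<bullet> ?e"
        unfolding of_int_bit_eq_0_iff [symmetric] of_int_diff
        using w by (simp only: of_int_scalar_prod_int_vec carrier_vecD index_unit_vec right_minus_eq)
      then show "w $ i = w' $ i" using i by (simp only: scalar_prod_right_unit)
    qed (use w in simp)
    ultimately show ?thesis using \<kappa>_eq by blast
  qed
  then show ?thesis by (force simp: inj_on_def)
qed

lemma hamming_weight_codeword:
  assumes "distinct xs" "set xs = carrier_vec m"
  shows "int (hamming_weight (codeword xs z w \<kappa>)) = 2 ^ m - kerdock_sum m (kerdock_mat z) w \<kappa>"
  unfolding codeword_def hamming_weight_gray_map kerdock_sum_def
  using assms by (simp add: sum_list_distinct_conv_sum_set sum_subtractf card_carrier_bit_vec)

text \<open>The weight condition is stated over the integers, where the exponential sum may be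
  negative and no truncated subtraction occurs.\<close>

definition shift_count :: "'a \<Rightarrow> bit vec \<Rightarrow> nat \<Rightarrow> nat" where
  "shift_count z w i = card {\<kappa> \<in> {0, 1, 2, 3}. 2 ^ m - kerdock_sum m (kerdock_mat z) w \<kappa> = int i}"

text \<open>Injectivity of the parametrization replaces the count of codewords by a count of
  parameter triples.\<close>

lemma weight_distribution_eq_sum:
  assumes "distinct xs" "set xs = carrier_vec m"
  shows "weight_distribution (binary_kerdock_code \<alpha> m xs) i =
    (\<Sum>z\<in>UNIV. \<Sum>w\<in>carrier_vec m. shift_count z w i)"
proof -
  let ?g = "\<lambda>(z, w, \<kappa>). codeword xs z w \<kappa>"
  let ?S = "SIGMA z : UNIV. SIGMA w : carrier_vec m.
    {\<kappa> \<in> {0, 1, 2, 3}. 2 ^ m - kerdock_sum m (kerdock_mat z) w \<kappa> = int i}"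
  have weight: "hamming_weight (codeword xs z w \<kappa>) = i \<longleftrightarrow>
      2 ^ m - kerdock_sum m (kerdock_mat z) w \<kappa> = int i" for z w \<kappa>
    unfolding hamming_weight_codeword [OF assms, symmetric] by (rule of_nat_eq_iff [symmetric])
  have "{c \<in> ?g ` params. hamming_weight c = i} = ?g ` {p \<in> params. hamming_weight (?g p) = i}"
    by blast
  also have "{p \<in> params. hamming_weight (?g p) = i} = ?S"
    unfolding weight [symmetric] by auto
  finally have "weight_distribution (binary_kerdock_code \<alpha> m xs) i = card (?g ` ?S)"
    unfolding weight_distribution_def binary_kerdock_code_eq by (rule arg_cong)
  also have "\<dots> = card ?S"
    by (intro card_image inj_on_subset [OF inj_codeword [OF assms(2)]]) auto
  also have "\<dots> = (\<Sum>z\<in>UNIV. \<Sum>w\<in>carrier_vec m. shift_count z w i)"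
    unfolding shift_count_def
    by (subst card_SigmaI [OF finite_UNIV]) (auto simp: card_SigmaI finite_carrier_bit_vec)
  finally show ?thesis .
qed

section \<open>Weights for a fixed matrix and linear part\<close>

lemma shift_count_eq_sum:
  "shift_count z w i =
    (\<Sum>\<kappa>\<in>{0, 1, 2, 3}. if 2 ^ m - kerdock_sum m (kerdock_mat z) w \<kappa> = int i then 1 else 0)"
  unfolding shift_count_def card_eq_sum by (rule sum.inter_filter) simp

text \<open>The four sums form two pairs of opposite values, and each pair gives both weights
  once.\<close>

lemma shift_count_nonzero:
  assumes "odd m" "z \<noteq> 0" "w \<in> carrier_vec m"
  shows "shift_count z w i =
    (if i = 2 ^ m - 2 ^ ((m - 1) div 2) \<or> i = 2 ^ m + 2 ^ ((m - 1) div 2) then 2 else 0)"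
proof -
  let ?T = "kerdock_sum m (kerdock_mat z) w"
  define e :: nat where "e = 2 ^ ((m - 1) div 2)"
  \<comment> \<open>The upper bound makes the natural subtraction in the lower weight exact;
    positivity keeps the two weights apart.\<close>
  have e: "0 < e" "e \<le> 2 ^ m" by (auto simp: e_def intro!: power_increasing)
  have cases: "?T \<kappa> = int e \<or> ?T \<kappa> = - int e" for \<kappa>
    using kerdock_sum_cases [OF kerdock_mat_carrier kerdock_mat_symmetric assms(3)
      kerdock_mat_nondegenerate [OF assms(2)] assms(1)] by (simp add: e_def)
  have T: "?T 2 = - ?T 0" "?T 3 = - ?T 1"
    using kerdock_sum_add_2 [of m "kerdock_mat z" w 0] kerdock_sum_add_2 [of m "kerdock_mat z" w 1] by simp_all
  define a b where "a = 2 ^ m - e" and "b = 2 ^ m + e"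
  have ab: "2 ^ m - int e = int a" "2 ^ m + int e = int b" "a \<noteq> b"
    using e by (simp_all add: a_def b_def of_nat_diff)
  have "shift_count z w i =
      (if 2 ^ m - ?T 0 = int i then 1 else 0) + (if 2 ^ m - ?T 1 = int i then 1 else 0)
      + (if 2 ^ m + ?T 0 = int i then 1 else 0) + (if 2 ^ m + ?T 1 = int i then 1 else 0)"
    by (simp add: shift_count_eq_sum T)
  also have "\<dots> = (if i = a \<or> i = b then 2 else 0)"
    using cases [of 0] cases [of 1] ab(3)
    by (elim disjE) (simp_all only: diff_minus_eq_add add_uminus_conv_diff ab(1,2) of_nat_eq_iff, auto)
  finally show ?thesis unfolding a_def b_def e_def .
qed

text \<open>A nontrivial linear part makes the sum vanish for every \<open>\<kappa>\<close>.\<close>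

lemma shift_count_0:
  assumes "w \<in> carrier_vec m" "w \<noteq> 0\<^sub>v m"
  shows "shift_count 0 w i = (if i = 2 ^ m then 4 else 0)"
proof -
  have "(2 ^ m = int i) \<longleftrightarrow> i = 2 ^ m" by (metis of_nat_eq_iff of_nat_numeral of_nat_power)
  then show ?thesis
    unfolding shift_count_eq_sum kerdock_mat_0 kerdock_sum_zero_mat [OF assms(1)] using assms(2) by simp
qed

text \<open>These are the constant words: 0 and 2 give the all-zero and all-one binary words, while
  1 and 3 give one nonzero bit per block.\<close>

lemma shift_count_0_0:
  "shift_count 0 (0\<^sub>v m) i = (if i = 0 \<or> i = 2 ^ (m + 1) then 1 else if i = 2 ^ m then 2 else 0)"
proof -
  have "(2 :: int) ^ m = int (2 ^ m)" "2 * (2 :: int) ^ m = int (2 ^ (m + 1))"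
    by simp_all
  then have "(2 ^ m = int i) \<longleftrightarrow> i = 2 ^ m" "(2 * 2 ^ m = int i) \<longleftrightarrow> i = 2 ^ (m + 1)"
    by (simp_all only: of_nat_eq_iff) (rule eq_commute)+
  then show ?thesis
    unfolding shift_count_eq_sum kerdock_mat_0 kerdock_sum_zero_mat [OF zero_carrier_vec]
    by (auto simp: re4_def)
qed

text \<open>The three summands belong to the constant words, to the other words with
  \<open>z = 0\<close>, and to the words with nonzero \<open>z\<close>.\<close>

lemma weight_distribution_kerdock:
  assumes "odd m" "distinct xs" "set xs = carrier_vec m"
  shows "weight_distribution (binary_kerdock_code \<alpha> m xs) i =
    (if i = 0 \<or> i = 2 ^ (m + 1) then 1 else if i = 2 ^ m then 2 else 0)
    + (2 ^ m - 1) * (if i = 2 ^ m then 4 else 0)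
    + (2 ^ m - 1) * (2 ^ m *
        (if i = 2 ^ m - 2 ^ ((m - 1) div 2) \<or> i = 2 ^ m + 2 ^ ((m - 1) div 2) then 2 else 0))"
  (is "_ = ?a + (2 ^ m - 1) * ?b + (2 ^ m - 1) * (2 ^ m * ?c)")
proof -
  let ?V = "carrier_vec m :: bit vec set"
  have "(\<Sum>w\<in>?V. shift_count 0 w i) = shift_count 0 (0\<^sub>v m) i + (\<Sum>w\<in>?V - {0\<^sub>v m}. shift_count 0 w i)"
    by (rule sum.remove [OF finite_carrier_bit_vec zero_carrier_vec])
  also have "(\<Sum>w\<in>?V - {0\<^sub>v m}. shift_count 0 w i) = (\<Sum>w\<in>?V - {0\<^sub>v m}. ?b)"
    by (intro sum.cong refl shift_count_0) auto
  also have "\<dots> = (2 ^ m - 1) * ?b"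
    by (simp only: sum_constant card_Diff_singleton [OF zero_carrier_vec] card_carrier_bit_vec of_nat_id)
  finally have zero: "(\<Sum>w\<in>?V. shift_count 0 w i) = ?a + (2 ^ m - 1) * ?b"
    by (simp only: shift_count_0_0)
  have "(\<Sum>z\<in>UNIV - {0}. \<Sum>w\<in>?V. shift_count z w i) = (\<Sum>z\<in>UNIV - {0 :: 'a}. \<Sum>w\<in>?V. ?c)"
    by (intro sum.cong refl shift_count_nonzero assms) auto
  also have "\<dots> = (2 ^ m - 1) * (2 ^ m * ?c)"
    by (simp only: sum_constant card_Diff_singleton [OF UNIV_I] card_UNIV_eq card_carrier_bit_vec of_nat_id)
  finally show ?thesis
    unfolding weight_distribution_eq_sum [OF assms(2,3)] sum.remove [OF finite_UNIV UNIV_I [of 0]] zero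
    by (simp only:)
qed

end

theorem theorem1:
  fixes m :: nat and f :: "bit poly" and \<alpha> :: "'a::field"
    and xs :: "bit vec list" and A :: "nat \<Rightarrow> nat"
  assumes "odd m"
    and "primitive_polynomial f" and "degree f = m"
    and "adjoins_root f \<alpha>"
    and "distinct xs" and "set xs = carrier_vec m"
    and "A = weight_distribution (binary_kerdock_code \<alpha> m xs)"
  shows "A 0 = 1 \<and>
    A (2 ^ m - 2 ^ ((m - 1) div 2)) = 2 ^ (2 * m + 1) - 2 ^ (m + 1) \<and>
    A (2 ^ m) = 2 ^ (m + 2) - 2 \<and>
    A (2 ^ m + 2 ^ ((m - 1) div 2)) = 2 ^ (2 * m + 1) - 2 ^ (m + 1) \<and>
    A (2 ^ (m + 1)) = 1 \<and>
    (\<forall>i \<le> 2 ^ (m + 1).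
       i \<notin> {0, 2 ^ m - 2 ^ ((m - 1) div 2), 2 ^ m, 2 ^ m + 2 ^ ((m - 1) div 2), 2 ^ (m + 1)}
         \<longrightarrow> A i = 0)"
proof -
  interpret binary_field_extension f \<alpha> m
    using assms(2-4) by unfold_locales (auto simp: primitive_polynomial_def)
  define n e :: nat where "n = 2 ^ m" and "e = 2 ^ ((m - 1) div 2)"
  have A: "A i = (if i = 0 \<or> i = 2 * n then 1 else if i = n then 2 else 0)
    + (n - 1) * (if i = n then 4 else 0) + (n - 1) * (n * (if i = n - e \<or> i = n + e then 2 else 0))" for i
    unfolding assms(7) weight_distribution_kerdock [OF assms(1,5,6)] n_def e_def by simp
  have "0 < e" "e < n"
    using degree_pos by (auto simp: n_def e_def intro!: power_strict_increasing)
  moreover have "2 ^ (m + 1) = 2 * n" "2 ^ (2 * m + 1) = 2 * n * n" "2 ^ (m + 2) = 4 * n"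
    by (simp_all add: n_def power_add mult_2 distrib_right)
  \<comment> \<open>The weights are pairwise distinct, so each conditional in the count resolves to
    a single branch.\<close>
  moreover have "n - e \<noteq> 0" "n - e \<noteq> n" "n - e \<noteq> 2 * n" "n - e \<noteq> n + e" "n + e \<noteq> 2 * n" "n \<noteq> 0"
    using \<open>0 < e\<close> \<open>e < n\<close> by linarith+
  \<comment> \<open>The outer weights receive two words for each nonzero \<open>z\<close> and each
    \<open>w\<close>; the middle weight receives two constant words and four for each nonzero
    \<open>w\<close> with \<open>z = 0\<close>.\<close>
  moreover have "(n - 1) * (n * 2) = 2 * n * n - 2 * n" "2 + (n - 1) * 4 = 4 * n - 2"
    using \<open>e < n\<close> by (simp_all add: diff_mult_distrib)
  ultimately show ?thesis
    unfolding n_def [symmetric] e_def [symmetric] by (simp add: A)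
qed

end
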